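(* Let $(G,\le)$ be a totally ordered set and let $\Omega=\{\Omega_k\}_{k\in G}$ be a pre-stratifying system in an abelian length category $\mathcal{A}$ (as in the context). Then $\Omega$ induces two distinct nested families of torsion pairs $\Gamma$ and $\Gamma'$, both indexed by $G$, such that the characteristic object $M^{\Omega}_\bullet=(\Omega_k)_{k\in G}$ is in $\mathcal{M}^{*}(\Gamma)$ and in $\mathcal{N}^{*}(\Gamma')$.
   Context: Throughout, $\mathcal{A}$ is a $k$-linear, Hom-finite, skeletally small abelian category over an algebraically closed field $k$, in which every object has finite length. A pre-stratifying system indexed by a totally ordered set $G$ is a family $\{\Omega_k\}_{k\in G}$ of non-zero objects of $\mathcal{A}$ with $\mathrm{Hom}_{\mathcal{A}}(\Omega_k,\Omega_j)=0$ whenever $k>j$ and $\mathrm{Ext}^1_{\mathcal{A}}(\Omega_k,\Omega_j)=0$ whenever $k\ge j$. For a class $\mathcal{C}$, $\mathcal{C}^{\bot}=\{M\mid \mathrm{Hom}_{\mathcal{A}}(C,M)=0\ \forall C\in\mathcal{C}\}$, ${}^{\bot}\mathcal{C}=\{M\mid \mathrm{Hom}_{\mathcal{A}}(M,C)=0\ \forall C\in\mathcal{C}\}$, $\mathsf{T}(\mathcal{C})={}^{\bot}(\mathcal{C}^{\bot})$ (smallest torsion class containing $\mathcal{C}$), $\mathsf{F}(\mathcal{C})=({}^{\bot}\mathcal{C})^{\bot}$ (smallest torsion-free class containing $\mathcal{C}$). A torsion pair $(\mathcal{T},\mathcal{F})$ is a pair of full subcategories with no non-zero morphisms from objects of $\mathcal{T}$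 to objects of $\mathcal{F}$ such that each $M\in\mathcal{A}$ admits a short exact sequence $0\to t(M)\to M\to f(M)\to0$ with $t(M)\in\mathcal{T}$, $f(M)\in\mathcal{F}$. A nested family of torsion pairs indexed by $G$ is a family $\{(\mathcal{T}_k,\mathcal{F}_k)\}_{k\in G}$ of torsion pairs with $\mathcal{T}_k\supsetneq\mathcal{T}_l$ whenever $k<l$ (equivalently $\mathcal{F}_k\subsetneq\mathcal{F}_l$ whenever $k<l$); two such families are distinct if they differ as families indexed by $G$. $\mathrm{Gr}_G(\mathcal{A})$ is the category of families $(M_k)_{k\in G}$ of objects of $\mathcal{A}$, with componentwise morphisms. $\Omega$ T-induces a nested family if that family is $\{(\mathsf{T}(\{\Omega_j\mid j\ge k\}),(\{\Omega_j\mid j\ge k\})^{\bot})\}_{k\in G}$; $\Omega$ F-induces a nested family if that family is $\{({}^{\bot}(\{\Omega_j\mid j\le k\}),\mathsf{F}(\{\Omega_j\mid j\le k\}))\}_{k\in G}$; $\Omega$ induces a nested family if it T-induces or F-induces it. For a nested family $\Gamma=\{(\mathcal{T}_k,\mathcal{F}_k)\}_{k\in G}$: $\mathcal{M}^*(\Gamma)$ is the full subcategory of $\mathrm{Gr}_G(\mathcal{A})$ consisting of $0_\bullet=(0)_{k\in G}$ and the $(M_k)_{k\in G}$ such that for all $k$: $M_k\ne0$, $M_k\in\mathcal{T}_k$, and for all $j>k$, $M_k\notin\mathcal{T}_j$ and $M_k\in\mathcal{F}_j$. $\mathcal{N}^*(\Gamma)$ is the full subcategory consisting of $0_\bullet$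 and the $(N_k)_{k\in G}$ such that for all $k$: $N_k\ne0$, $N_k\in\mathcal{F}_k$, and for all $j<k$, $N_k\notin\mathcal{F}_j$ and $N_k\in\mathcal{T}_j$. *)

theory Defs
  imports "HOL-Algebra.Algebraic_Closure"
begin

no_notation var (\<open>X\<index>\<close>)

section \<open>Linear categories\<close>

text \<open>
  A category enriched in modules over a ring with carrier type \<open>'k\<close>. The composite of \<open>f : X \<rightarrow> Y\<close>
  with \<open>g : Y \<rightarrow> Z\<close> is \<open>g \<cdot> f\<close>. Hom-sets are not required to be disjoint, so every notion about a
  morphism below carries its source and target explicitly. As in HOL-Algebra, a hom-module is a ring
  record of which only the additive part and \<open>smult\<close> are used.

  The objects form a set in a HOL type, which is how the assumption that the category be skeletally
  small is rendered: being a set is built into the type, and the isomorphism classes of objects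
  then form a set as well.
\<close>

record ('k, 'o, 'm) lin_cat =
  Ob :: "'o set"
  Hom :: "'o \<Rightarrow> 'o \<Rightarrow> ('k, 'm) module"
  Comp :: "'m \<Rightarrow> 'm \<Rightarrow> 'm"  (infixl \<open>\<cdot>\<index>\<close> 70)
  ident :: "'o \<Rightarrow> 'm"

abbreviation mor :: "('k, 'o, 'm) lin_cat \<Rightarrow> 'o \<Rightarrow> 'o \<Rightarrow> 'm set"
  where "mor C X Y \<equiv> carrier (Hom C X Y)"

abbreviation zero_mor :: "('k, 'o, 'm) lin_cat \<Rightarrow> 'o \<Rightarrow> 'o \<Rightarrow> 'm"
  where "zero_mor C X Y \<equiv> \<zero>\<^bsub>Hom C X Y\<^esub>"

definition Hom_vanishes :: "('k, 'o, 'm) lin_cat \<Rightarrow> 'o \<Rightarrow> 'o \<Rightarrow> bool"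
  where "Hom_vanishes C X Y \<longleftrightarrow> mor C X Y = {zero_mor C X Y}"

locale linear_category = algebraically_closed K
  for K :: "'k ring" (structure) and C :: "('k, 'o, 'm) lin_cat" +
  assumes hom_module: "\<lbrakk>X \<in> Ob C; Y \<in> Ob C\<rbrakk> \<Longrightarrow> module K (Hom C X Y)"
    and ident_mor: "X \<in> Ob C \<Longrightarrow> ident C X \<in> mor C X X"
    and comp_mor: "\<lbrakk>X \<in> Ob C; Y \<in> Ob C; Z \<in> Ob C; f \<in> mor C X Y; g \<in> mor C Y Z\<rbrakk>
      \<Longrightarrow> g \<cdot>\<^bsub>C\<^esub> f \<in> mor C X Z"
    and ident_left: "\<lbrakk>X \<in> Ob C; Y \<in> Ob C; f \<in> mor C X Y\<rbrakk> \<Longrightarrow> ident C Y \<cdot>\<^bsub>C\<^esub> f = f"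
    and ident_right: "\<lbrakk>X \<in> Ob C; Y \<in> Ob C; f \<in> mor C X Y\<rbrakk> \<Longrightarrow> f \<cdot>\<^bsub>C\<^esub> ident C X = f"
    and comp_assoc: "\<lbrakk>W \<in> Ob C; X \<in> Ob C; Y \<in> Ob C; Z \<in> Ob C;
        f \<in> mor C W X; g \<in> mor C X Y; h \<in> mor C Y Z\<rbrakk>
      \<Longrightarrow> (h \<cdot>\<^bsub>C\<^esub> g) \<cdot>\<^bsub>C\<^esub> f = h \<cdot>\<^bsub>C\<^esub> (g \<cdot>\<^bsub>C\<^esub> f)"
    and comp_add_right: "\<lbrakk>X \<in> Ob C; Y \<in> Ob C; Z \<in> Ob C;
        f \<in> mor C X Y; f' \<in> mor C X Y; g \<in> mor C Y Z\<rbrakk>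
      \<Longrightarrow> g \<cdot>\<^bsub>C\<^esub> (f \<oplus>\<^bsub>Hom C X Y\<^esub> f') = (g \<cdot>\<^bsub>C\<^esub> f) \<oplus>\<^bsub>Hom C X Z\<^esub> (g \<cdot>\<^bsub>C\<^esub> f')"
    and comp_add_left: "\<lbrakk>X \<in> Ob C; Y \<in> Ob C; Z \<in> Ob C;
        f \<in> mor C X Y; g \<in> mor C Y Z; g' \<in> mor C Y Z\<rbrakk>
      \<Longrightarrow> (g \<oplus>\<^bsub>Hom C Y Z\<^esub> g') \<cdot>\<^bsub>C\<^esub> f = (g \<cdot>\<^bsub>C\<^esub> f) \<oplus>\<^bsub>Hom C X Z\<^esub> (g' \<cdot>\<^bsub>C\<^esub> f)"
    and comp_smult_right: "\<lbrakk>X \<in> Ob C; Y \<in> Ob C; Z \<in> Ob C;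
        a \<in> carrier K; f \<in> mor C X Y; g \<in> mor C Y Z\<rbrakk>
      \<Longrightarrow> g \<cdot>\<^bsub>C\<^esub> (a \<odot>\<^bsub>Hom C X Y\<^esub> f) = a \<odot>\<^bsub>Hom C X Z\<^esub> (g \<cdot>\<^bsub>C\<^esub> f)"
    and comp_smult_left: "\<lbrakk>X \<in> Ob C; Y \<in> Ob C; Z \<in> Ob C;
        a \<in> carrier K; f \<in> mor C X Y; g \<in> mor C Y Z\<rbrakk>
      \<Longrightarrow> (a \<odot>\<^bsub>Hom C Y Z\<^esub> g) \<cdot>\<^bsub>C\<^esub> f = a \<odot>\<^bsub>Hom C X Z\<^esub> (g \<cdot>\<^bsub>C\<^esub> f)"


section \<open>Abelian length categories\<close>

definition is_zero_obj :: "('k, 'o, 'm) lin_cat \<Rightarrow> 'o \<Rightarrow> bool"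
  where "is_zero_obj C Z \<longleftrightarrow>
    Z \<in> Ob C \<and> (\<forall>X\<in>Ob C. (\<exists>!f. f \<in> mor C X Z) \<and> (\<exists>!f. f \<in> mor C Z X))"

definition is_mono :: "('k, 'o, 'm) lin_cat \<Rightarrow> 'o \<Rightarrow> 'o \<Rightarrow> 'm \<Rightarrow> bool"
  where "is_mono C X Y f \<longleftrightarrow> f \<in> mor C X Y \<and>
    (\<forall>W\<in>Ob C. \<forall>g\<in>mor C W X. \<forall>h\<in>mor C W X. f \<cdot>\<^bsub>C\<^esub> g = f \<cdot>\<^bsub>C\<^esub> h \<longrightarrow> g = h)"

definition is_epi :: "('k, 'o, 'm) lin_cat \<Rightarrow> 'o \<Rightarrow> 'o \<Rightarrow> 'm \<Rightarrow> bool"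
  where "is_epi C X Y f \<longleftrightarrow> f \<in> mor C X Y \<and>
    (\<forall>Z\<in>Ob C. \<forall>g\<in>mor C Y Z. \<forall>h\<in>mor C Y Z. g \<cdot>\<^bsub>C\<^esub> f = h \<cdot>\<^bsub>C\<^esub> f \<longrightarrow> g = h)"

definition is_iso :: "('k, 'o, 'm) lin_cat \<Rightarrow> 'o \<Rightarrow> 'o \<Rightarrow> 'm \<Rightarrow> bool"
  where "is_iso C X Y f \<longleftrightarrow> f \<in> mor C X Y \<and>
    (\<exists>g\<in>mor C Y X. g \<cdot>\<^bsub>C\<^esub> f = ident C X \<and> f \<cdot>\<^bsub>C\<^esub> g = ident C Y)"

text \<open>\<open>i : A \<rightarrow> X\<close> is a kernel of \<open>f : X \<rightarrow> Y\<close>, and \<open>p : Y \<rightarrow> B\<close> is a cokernel of \<open>f : X \<rightarrow> Y\<close>.\<close>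

definition is_kernel :: "('k, 'o, 'm) lin_cat \<Rightarrow> 'o \<Rightarrow> 'm \<Rightarrow> 'o \<Rightarrow> 'm \<Rightarrow> 'o \<Rightarrow> bool"
  where "is_kernel C A i X f Y \<longleftrightarrow>
    A \<in> Ob C \<and> i \<in> mor C A X \<and> f \<cdot>\<^bsub>C\<^esub> i = zero_mor C A Y \<and>
    (\<forall>W\<in>Ob C. \<forall>g\<in>mor C W X. f \<cdot>\<^bsub>C\<^esub> g = zero_mor C W Y \<longrightarrow>
      (\<exists>!h. h \<in> mor C W A \<and> i \<cdot>\<^bsub>C\<^esub> h = g))"

definition is_cokernel :: "('k, 'o, 'm) lin_cat \<Rightarrow> 'o \<Rightarrow> 'm \<Rightarrow> 'o \<Rightarrow> 'm \<Rightarrow> 'o \<Rightarrow> bool"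
  where "is_cokernel C X f Y p B \<longleftrightarrow>
    B \<in> Ob C \<and> p \<in> mor C Y B \<and> p \<cdot>\<^bsub>C\<^esub> f = zero_mor C X B \<and>
    (\<forall>W\<in>Ob C. \<forall>g\<in>mor C Y W. g \<cdot>\<^bsub>C\<^esub> f = zero_mor C X W \<longrightarrow>
      (\<exists>!h. h \<in> mor C B W \<and> h \<cdot>\<^bsub>C\<^esub> p = g))"

definition is_biproduct ::
    "('k, 'o, 'm) lin_cat \<Rightarrow> 'o \<Rightarrow> 'o \<Rightarrow> 'o \<Rightarrow> 'm \<Rightarrow> 'm \<Rightarrow> 'm \<Rightarrow> 'm \<Rightarrow> bool"
  where "is_biproduct C X Y B i j p q \<longleftrightarrow>
    B \<in> Ob C \<and> i \<in> mor C X B \<and> j \<in> mor C Y B \<and> p \<in> mor C B X \<and> q \<in> mor C B Y \<and>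
    p \<cdot>\<^bsub>C\<^esub> i = ident C X \<and> q \<cdot>\<^bsub>C\<^esub> j = ident C Y \<and>
    p \<cdot>\<^bsub>C\<^esub> j = zero_mor C Y X \<and> q \<cdot>\<^bsub>C\<^esub> i = zero_mor C X Y \<and>
    (i \<cdot>\<^bsub>C\<^esub> p) \<oplus>\<^bsub>Hom C B B\<^esub> (j \<cdot>\<^bsub>C\<^esub> q) = ident C B"

text \<open>\<open>0 \<rightarrow> A \<rightarrow> X \<rightarrow> B \<rightarrow> 0\<close> with maps \<open>i\<close> and \<open>p\<close>.\<close>

definition short_exact :: "('k, 'o, 'm) lin_cat \<Rightarrow> 'o \<Rightarrow> 'm \<Rightarrow> 'o \<Rightarrow> 'm \<Rightarrow> 'o \<Rightarrow> bool"
  where "short_exact C A i X p B \<longleftrightarrow> X \<in> Ob C \<and> is_kernel C A i X p B \<and> is_cokernel C A i X p B"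

definition is_simple :: "('k, 'o, 'm) lin_cat \<Rightarrow> 'o \<Rightarrow> bool"
  where "is_simple C S \<longleftrightarrow> S \<in> Ob C \<and> \<not> is_zero_obj C S \<and>
    (\<forall>A\<in>Ob C. \<forall>i. is_mono C A S i \<longrightarrow> is_zero_obj C A \<or> is_iso C A S i)"

text \<open>Finite length: existence of a composition series \<open>0 = Y 0 \<subset> \<dots> \<subset> Y n = X\<close> with simple factors
  \<open>S 0, \<dots>, S (n - 1)\<close>.\<close>

definition finite_length :: "('k, 'o, 'm) lin_cat \<Rightarrow> 'o \<Rightarrow> bool"
  where "finite_length C X \<longleftrightarrow>
    (\<exists>(n :: nat) Y i p S. is_zero_obj C (Y 0) \<and> Y n = X \<and>
      (\<forall>r<n. short_exact C (Y r) (i r) (Y (Suc r)) (p r) (S r) \<and> is_simple C (S r)))"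

definition finite_dim :: "'k ring \<Rightarrow> ('k, 'm) module \<Rightarrow> bool"
  where "finite_dim K M \<longleftrightarrow> (\<exists>A. finite A \<and> A \<subseteq> carrier M \<and>
    (\<forall>x\<in>carrier M. \<exists>c\<in>A \<rightarrow> carrier K. x = (\<Oplus>\<^bsub>M\<^esub>a\<in>A. c a \<odot>\<^bsub>M\<^esub> a)))"

locale abelian_category = linear_category +
  assumes zero_obj_exists: "\<exists>Z. is_zero_obj C Z"
    and biproduct_exists: "\<lbrakk>X \<in> Ob C; Y \<in> Ob C\<rbrakk> \<Longrightarrow> \<exists>B i j p q. is_biproduct C X Y B i j p q"
    and kernel_exists: "\<lbrakk>X \<in> Ob C; Y \<in> Ob C; f \<in> mor C X Y\<rbrakk> \<Longrightarrow> \<exists>A i. is_kernel C A i X f Y"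
    and cokernel_exists: "\<lbrakk>X \<in> Ob C; Y \<in> Ob C; f \<in> mor C X Y\<rbrakk> \<Longrightarrow> \<exists>B p. is_cokernel C X f Y p B"
    and mono_normal: "\<lbrakk>X \<in> Ob C; Y \<in> Ob C; is_mono C X Y f\<rbrakk>
      \<Longrightarrow> \<exists>Z\<in>Ob C. \<exists>g\<in>mor C Y Z. is_kernel C X f Y g Z"
    and epi_normal: "\<lbrakk>X \<in> Ob C; Y \<in> Ob C; is_epi C X Y f\<rbrakk>
      \<Longrightarrow> \<exists>Z\<in>Ob C. \<exists>g\<in>mor C Z X. is_cokernel C Z g X f Y"

locale abelian_length_category = abelian_category +
  assumes hom_finite: "\<lbrakk>X \<in> Ob C; Y \<in> Ob C\<rbrakk> \<Longrightarrow> finite_dim K (Hom C X Y)"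
    and all_finite_length: "X \<in> Ob C \<Longrightarrow> finite_length C X"


section \<open>Yoneda extensions\<close>

text \<open>Elements of \<open>Ext\<^sup>1(X, Y)\<close> are equivalence classes of extensions \<open>0 \<rightarrow> Y \<rightarrow> E \<rightarrow> X \<rightarrow> 0\<close>,
  encoded as triples \<open>(i, E, p)\<close>; the zero element is the class of the split extension
  \<open>0 \<rightarrow> Y \<rightarrow> Y \<oplus> X \<rightarrow> X \<rightarrow> 0\<close>.\<close>

definition extensions :: "('k, 'o, 'm) lin_cat \<Rightarrow> 'o \<Rightarrow> 'o \<Rightarrow> ('m \<times> 'o \<times> 'm) set"
  where "extensions C X Y = {(i, E, p). short_exact C Y i E p X}"

definition ext_equiv ::
    "('k, 'o, 'm) lin_cat \<Rightarrow> 'o \<Rightarrow> 'o \<Rightarrow> (('m \<times> 'o \<times> 'm) \<times> ('m \<times> 'o \<times> 'm)) set"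
  where "ext_equiv C X Y = {((i, E, p), (i', E', p')).
    (i, E, p) \<in> extensions C X Y \<and> (i', E', p') \<in> extensions C X Y \<and>
    (\<exists>f. is_iso C E E' f \<and> f \<cdot>\<^bsub>C\<^esub> i = i' \<and> p' \<cdot>\<^bsub>C\<^esub> f = p)}"

definition Ext1 :: "('k, 'o, 'm) lin_cat \<Rightarrow> 'o \<Rightarrow> 'o \<Rightarrow> ('m \<times> 'o \<times> 'm) set set"
  where "Ext1 C X Y = extensions C X Y // ext_equiv C X Y"

definition Ext1_zero :: "('k, 'o, 'm) lin_cat \<Rightarrow> 'o \<Rightarrow> 'o \<Rightarrow> ('m \<times> 'o \<times> 'm) set"
  where "Ext1_zero C X Y =
    {e. \<exists>B i j p q. is_biproduct C Y X B i j p q \<and> ((i, B, q), e) \<in> ext_equiv C X Y}"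

definition Ext1_vanishes :: "('k, 'o, 'm) lin_cat \<Rightarrow> 'o \<Rightarrow> 'o \<Rightarrow> bool"
  where "Ext1_vanishes C X Y \<longleftrightarrow> Ext1 C X Y = {Ext1_zero C X Y}"


section \<open>Torsion pairs\<close>

text \<open>Full subcategories of the ambient category are given by their sets of objects.\<close>

definition right_perp :: "('k, 'o, 'm) lin_cat \<Rightarrow> 'o set \<Rightarrow> 'o set"
  where "right_perp C D = {M \<in> Ob C. \<forall>X\<in>D. Hom_vanishes C X M}"

definition left_perp :: "('k, 'o, 'm) lin_cat \<Rightarrow> 'o set \<Rightarrow> 'o set"
  where "left_perp C D = {M \<in> Ob C. \<forall>X\<in>D. Hom_vanishes C M X}"

definition torsion_closure :: "('k, 'o, 'm) lin_cat \<Rightarrow> 'o set \<Rightarrow> 'o set"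
  where "torsion_closure C D = left_perp C (right_perp C D)"

definition torsion_free_closure :: "('k, 'o, 'm) lin_cat \<Rightarrow> 'o set \<Rightarrow> 'o set"
  where "torsion_free_closure C D = right_perp C (left_perp C D)"

definition torsion_pair :: "('k, 'o, 'm) lin_cat \<Rightarrow> 'o set \<times> 'o set \<Rightarrow> bool"
  where "torsion_pair C = (\<lambda>(T, F). T \<subseteq> Ob C \<and> F \<subseteq> Ob C \<and>
    (\<forall>X\<in>T. \<forall>Y\<in>F. Hom_vanishes C X Y) \<and>
    (\<forall>M\<in>Ob C. \<exists>t\<in>T. \<exists>f\<in>F. \<exists>i p. short_exact C t i M p f))"

text \<open>The index type \<open>'g\<close> plays the role of the totally ordered set \<open>G\<close>, which is
  thereby non-empty; over an empty index set there is only one (empty) family.\<close>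

definition nested_family ::
    "('k, 'o, 'm) lin_cat \<Rightarrow> ('g :: linorder \<Rightarrow> 'o set \<times> 'o set) \<Rightarrow> bool"
  where "nested_family C \<Gamma> \<longleftrightarrow>
    (\<forall>k. torsion_pair C (\<Gamma> k)) \<and> (\<forall>k l. k < l \<longrightarrow> fst (\<Gamma> l) \<subset> fst (\<Gamma> k))"


section \<open>Pre-stratifying systems\<close>

definition pre_stratifying_system ::
    "('k, 'o, 'm) lin_cat \<Rightarrow> ('g :: linorder \<Rightarrow> 'o) \<Rightarrow> bool"
  where "pre_stratifying_system C \<Omega> \<longleftrightarrow>
    (\<forall>k. \<Omega> k \<in> Ob C \<and> \<not> is_zero_obj C (\<Omega> k)) \<and>
    (\<forall>k j. k > j \<longrightarrow> Hom_vanishes C (\<Omega> k) (\<Omega> j)) \<and>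
    (\<forall>k j. k \<ge> j \<longrightarrow> Ext1_vanishes C (\<Omega> k) (\<Omega> j))"

definition T_induces ::
    "('k, 'o, 'm) lin_cat \<Rightarrow> ('g :: linorder \<Rightarrow> 'o) \<Rightarrow> ('g \<Rightarrow> 'o set \<times> 'o set) \<Rightarrow> bool"
  where "T_induces C \<Omega> \<Gamma> \<longleftrightarrow> nested_family C \<Gamma> \<and>
    \<Gamma> = (\<lambda>k. (torsion_closure C {\<Omega> j | j. j \<ge> k}, right_perp C {\<Omega> j | j. j \<ge> k}))"

definition F_induces ::
    "('k, 'o, 'm) lin_cat \<Rightarrow> ('g :: linorder \<Rightarrow> 'o) \<Rightarrow> ('g \<Rightarrow> 'o set \<times> 'o set) \<Rightarrow> bool"
  where "F_induces C \<Omega> \<Gamma> \<longleftrightarrow> nested_family C \<Gamma> \<and>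
    \<Gamma> = (\<lambda>k. (left_perp C {\<Omega> j | j. j \<le> k}, torsion_free_closure C {\<Omega> j | j. j \<le> k}))"

definition induces ::
    "('k, 'o, 'm) lin_cat \<Rightarrow> ('g :: linorder \<Rightarrow> 'o) \<Rightarrow> ('g \<Rightarrow> 'o set \<times> 'o set) \<Rightarrow> bool"
  where "induces C \<Omega> \<Gamma> \<longleftrightarrow> T_induces C \<Omega> \<Gamma> \<or> F_induces C \<Omega> \<Gamma>"


section \<open>Graded objects\<close>

text \<open>The category \<open>Gr\<^sub>G(C)\<close>. The fields \<open>mult\<close> and \<open>one\<close> of its hom-modules are only there to fill
  the record.\<close>

definition Gr :: "('k, 'o, 'm) lin_cat \<Rightarrow> ('k, 'g \<Rightarrow> 'o, 'g \<Rightarrow> 'm) lin_cat"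
  where "Gr C = \<lparr>
    Ob = {M. \<forall>k. M k \<in> Ob C},
    Hom = (\<lambda>M N. \<lparr>
      carrier = {f. \<forall>k. f k \<in> mor C (M k) (N k)},
      monoid.mult = (\<lambda>f g k. f k \<otimes>\<^bsub>Hom C (M k) (N k)\<^esub> g k),
      one = (\<lambda>k. \<one>\<^bsub>Hom C (M k) (N k)\<^esub>),
      zero = (\<lambda>k. zero_mor C (M k) (N k)),
      add = (\<lambda>f g k. f k \<oplus>\<^bsub>Hom C (M k) (N k)\<^esub> g k),
      smult = (\<lambda>a f k. a \<odot>\<^bsub>Hom C (M k) (N k)\<^esub> f k)\<rparr>),
    Comp = (\<lambda>g f k. g k \<cdot>\<^bsub>C\<^esub> f k),
    ident = (\<lambda>M k. ident C (M k))\<rparr>"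

definition full_subcategory :: "('k, 'o, 'm) lin_cat \<Rightarrow> 'o set \<Rightarrow> ('k, 'o, 'm) lin_cat"
  where "full_subcategory C S = C\<lparr>Ob := Ob C \<inter> S\<rparr>"

text \<open>A zero object is only determined up to isomorphism; as \<open>0\<^sub>\<bullet>\<close> we admit every family of zero
  objects.\<close>

definition M_star :: "('k, 'o, 'm) lin_cat \<Rightarrow> ('g :: linorder \<Rightarrow> 'o set \<times> 'o set)
    \<Rightarrow> ('k, 'g \<Rightarrow> 'o, 'g \<Rightarrow> 'm) lin_cat"
  where "M_star C \<Gamma> = full_subcategory (Gr C)
    ({M. \<forall>k. is_zero_obj C (M k)} \<union>
     {M. \<forall>k. \<not> is_zero_obj C (M k) \<and> M k \<in> fst (\<Gamma> k) \<and>
       (\<forall>j>k. M k \<notin> fst (\<Gamma> j) \<and> M k \<in> snd (\<Gamma> j))})"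

definition N_star :: "('k, 'o, 'm) lin_cat \<Rightarrow> ('g :: linorder \<Rightarrow> 'o set \<times> 'o set)
    \<Rightarrow> ('k, 'g \<Rightarrow> 'o, 'g \<Rightarrow> 'm) lin_cat"
  where "N_star C \<Gamma> = full_subcategory (Gr C)
    ({N. \<forall>k. is_zero_obj C (N k)} \<union>
     {N. \<forall>k. \<not> is_zero_obj C (N k) \<and> N k \<in> snd (\<Gamma> k) \<and>
       (\<forall>j<k. N k \<notin> snd (\<Gamma> j) \<and> N k \<in> fst (\<Gamma> j))})"

end

theory Submission
  imports Defs
begin

text \<open>
  For every set \<open>D\<close> of objects of an abelian length category, \<open>(T(D), D\<^sup>\<bottom>)\<close> is a torsion pair: if
  \<open>M\<close> is not in \<open>D\<^sup>\<bottom>\<close>, a non-zero morphism from an object of \<open>D\<close> to \<open>M\<close> has an image \<open>I\<close> in \<open>T(D)\<close>,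
  and the preimage in \<open>M\<close> of the torsion part of the shorter object \<open>M/I\<close> is the torsion part of
  \<open>M\<close>. Applying this to \<open>\<^sup>\<bottom>D\<close> in place of \<open>D\<close> shows that \<open>(\<^sup>\<bottom>D, F(D))\<close> is a torsion pair too, so
  no dual argument is needed. Strictness of the inclusions, distinctness of the two families, and
  membership of \<open>\<Omega>\<close> then all follow from the vanishing of \<open>Hom(\<Omega> k, \<Omega> j)\<close> for \<open>k > j\<close>
  and the fact that a non-zero object has a non-zero endomorphism.
\<close>

section \<open>Linear categories\<close>

context linear_category
begin

section \<open>Morphisms with source and target, composites and zero morphisms\<close>

abbreviation comp (infixl \<open>\<bullet>\<close> 70) where "g \<bullet> f \<equiv> g \<cdot>\<^bsub>C\<^esub> f"

abbreviation zm (\<open>\<zero>[_,_]\<close>) where "\<zero>[X,Y] \<equiv> zero_mor C X Y"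

text \<open>Hom-sets may overlap, so a morphism does not determine its source and target; packing
  both with the membership leaves a single hypothesis per morphism.\<close>

definition arr :: "'o \<Rightarrow> 'o \<Rightarrow> 'm \<Rightarrow> bool"
  where "arr X Y f \<longleftrightarrow> X \<in> Ob C \<and> Y \<in> Ob C \<and> f \<in> mor C X Y"

lemma arr_Ob: "arr X Y f \<Longrightarrow> X \<in> Ob C" "arr X Y f \<Longrightarrow> Y \<in> Ob C"
  and arr_mor: "arr X Y f \<Longrightarrow> f \<in> mor C X Y"
  by (auto simp: arr_def)

lemma arr_comp [intro, simp]: "arr X Y f \<Longrightarrow> arr Y Z g \<Longrightarrow> arr X Z (g \<bullet> f)"
  using comp_mor by (auto simp: arr_def)

lemma arr_ident [intro, simp]: "X \<in> Ob C \<Longrightarrow> arr X X (ident C X)"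
  using ident_mor by (auto simp: arr_def)

lemma abelian_group_Hom: "X \<in> Ob C \<Longrightarrow> Y \<in> Ob C \<Longrightarrow> abelian_group (Hom C X Y)"
  using hom_module module.axioms(2) by blast

lemma arr_zero [intro, simp]: "X \<in> Ob C \<Longrightarrow> Y \<in> Ob C \<Longrightarrow> arr X Y \<zero>[X,Y]"
  using abelian_group_Hom abelian_group.axioms(1) abelian_monoid.zero_closed
  unfolding arr_def by blast

lemma assoc: "arr W X f \<Longrightarrow> arr X Y g \<Longrightarrow> arr Y Z h \<Longrightarrow> h \<bullet> g \<bullet> f = h \<bullet> (g \<bullet> f)"
  using comp_assoc by (auto simp: arr_def)

lemma ident_comp [simp]: "arr X Y f \<Longrightarrow> ident C Y \<bullet> f = f"
  and comp_ident [simp]: "arr X Y f \<Longrightarrow> f \<bullet> ident C X = f"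
  using ident_left ident_right by (auto simp: arr_def)

text \<open>By additivity the composite equals its own double, and zero is the only such element of
  a group.\<close>

lemma comp_zero [simp]:
  assumes "arr Y Z g" "X \<in> Ob C"
  shows "g \<bullet> \<zero>[X,Y] = \<zero>[X,Z]"
proof -
  have o: "Y \<in> Ob C" "Z \<in> Ob C" using assms by (auto simp: arr_def)
  interpret XY: abelian_group "Hom C X Y" using abelian_group_Hom o assms by blast
  interpret XZ: abelian_group "Hom C X Z" using abelian_group_Hom o assms by blast
  have c: "g \<bullet> \<zero>[X,Y] \<in> mor C X Z" using o assms comp_mor by (auto simp: arr_def)
  have "g \<bullet> (\<zero>[X,Y] \<oplus>\<^bsub>Hom C X Y\<^esub> \<zero>[X,Y]) = g \<bullet> \<zero>[X,Y] \<oplus>\<^bsub>Hom C X Z\<^esub> g \<bullet> \<zero>[X,Y]"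
    using comp_add_right o assms arr_mor by blast
  then show ?thesis using c by simp
qed

lemma zero_comp [simp]:
  assumes "arr X Y f" "Z \<in> Ob C"
  shows "\<zero>[Y,Z] \<bullet> f = \<zero>[X,Z]"
proof -
  have o: "X \<in> Ob C" "Y \<in> Ob C" using assms by (auto simp: arr_def)
  interpret YZ: abelian_group "Hom C Y Z" using abelian_group_Hom o assms by blast
  interpret XZ: abelian_group "Hom C X Z" using abelian_group_Hom o assms by blast
  have c: "\<zero>[Y,Z] \<bullet> f \<in> mor C X Z" using o assms comp_mor by (auto simp: arr_def)
  have "(\<zero>[Y,Z] \<oplus>\<^bsub>Hom C Y Z\<^esub> \<zero>[Y,Z]) \<bullet> f = \<zero>[Y,Z] \<bullet> f \<oplus>\<^bsub>Hom C X Z\<^esub> \<zero>[Y,Z] \<bullet> f"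
    using comp_add_left o assms arr_mor by blast
  then show ?thesis using c by simp
qed

section \<open>Monomorphisms and epimorphisms\<close>

lemma is_epiD: "is_epi C X Y f \<Longrightarrow> arr Y Z g \<Longrightarrow> arr Y Z h \<Longrightarrow> g \<bullet> f = h \<bullet> f \<Longrightarrow> g = h"
  by (auto simp: is_epi_def arr_def)

lemma is_monoD: "is_mono C X Y f \<Longrightarrow> arr W X g \<Longrightarrow> arr W X h \<Longrightarrow> f \<bullet> g = f \<bullet> h \<Longrightarrow> g = h"
  by (auto simp: is_mono_def arr_def)

lemma is_epi_zeroD:
  assumes "is_epi C X Y f" "X \<in> Ob C" "arr Y Z g" "g \<bullet> f = \<zero>[X,Z]"
  shows "g = \<zero>[Y,Z]"
proof -
  have "arr X Y f" using assms by (auto simp: is_epi_def arr_def)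
  then show ?thesis using assms is_epiD[of X Y f Z g "\<zero>[Y,Z]"] arr_Ob[OF assms(3)] by simp
qed

lemma is_mono_zeroD:
  assumes "is_mono C X Y f" "Y \<in> Ob C" "arr W X g" "f \<bullet> g = \<zero>[W,Y]"
  shows "g = \<zero>[W,X]"
proof -
  have "arr X Y f" using assms by (auto simp: is_mono_def arr_def)
  then show ?thesis using assms is_monoD[of X Y f W g "\<zero>[W,X]"] arr_Ob[OF assms(3)] by simp
qed

text \<open>Apply the hypothesis to the difference of the two morphisms to be identified.\<close>

lemma is_epiI:
  assumes f: "arr X Y f"
    and z: "\<And>Z h. arr Y Z h \<Longrightarrow> h \<bullet> f = \<zero>[X,Z] \<Longrightarrow> h = \<zero>[Y,Z]"
  shows "is_epi C X Y f"
  unfolding is_epi_def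
proof (intro conjI ballI impI)
  show "f \<in> mor C X Y" using f by (rule arr_mor)
  fix Z g h
  assume Z: "Z \<in> Ob C" and g: "g \<in> mor C Y Z" and h: "h \<in> mor C Y Z" and eq: "g \<bullet> f = h \<bullet> f"
  have o: "X \<in> Ob C" "Y \<in> Ob C" and fm: "f \<in> mor C X Y" using f by (auto simp: arr_def)
  interpret YZ: abelian_group "Hom C Y Z" using abelian_group_Hom o Z by blast
  interpret XZ: abelian_group "Hom C X Z" using abelian_group_Hom o Z by blast
  let ?n = "\<ominus>\<^bsub>Hom C Y Z\<^esub> h"
  have n: "?n \<in> mor C Y Z" using h by simp
  have "(g \<oplus>\<^bsub>Hom C Y Z\<^esub> ?n) \<bullet> f = (h \<oplus>\<^bsub>Hom C Y Z\<^esub> ?n) \<bullet> f"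
    using comp_add_left[OF o Z fm g n] comp_add_left[OF o Z fm h n] eq by simp
  also have "\<dots> = \<zero>[X,Z]" using h f Z by (simp add: YZ.r_neg)
  finally have "g \<oplus>\<^bsub>Hom C Y Z\<^esub> ?n = \<zero>[Y,Z]"
    using z g n o Z by (auto simp: arr_def)
  then show "g = h" using g h n by (metis YZ.minus_equality YZ.minus_minus)
qed

lemma is_monoI:
  assumes f: "arr X Y f"
    and z: "\<And>W h. arr W X h \<Longrightarrow> f \<bullet> h = \<zero>[W,Y] \<Longrightarrow> h = \<zero>[W,X]"
  shows "is_mono C X Y f"
  unfolding is_mono_def
proof (intro conjI ballI impI)
  show "f \<in> mor C X Y" using f by (rule arr_mor)
  fix W g h
  assume W: "W \<in> Ob C" and g: "g \<in> mor C W X" and h: "h \<in> mor C W X" and eq: "f \<bullet> g = f \<bullet> h"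
  have o: "X \<in> Ob C" "Y \<in> Ob C" and fm: "f \<in> mor C X Y" using f by (auto simp: arr_def)
  interpret WX: abelian_group "Hom C W X" using abelian_group_Hom o W by blast
  interpret WY: abelian_group "Hom C W Y" using abelian_group_Hom o W by blast
  let ?n = "\<ominus>\<^bsub>Hom C W X\<^esub> h"
  have n: "?n \<in> mor C W X" using h by simp
  have "f \<bullet> (g \<oplus>\<^bsub>Hom C W X\<^esub> ?n) = f \<bullet> (h \<oplus>\<^bsub>Hom C W X\<^esub> ?n)"
    using comp_add_right[OF W o g n fm] comp_add_right[OF W o h n fm] eq by simp
  also have "\<dots> = \<zero>[W,Y]" using h f W by (simp add: WX.r_neg)
  finally have "g \<oplus>\<^bsub>Hom C W X\<^esub> ?n = \<zero>[W,X]"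
    using z g n o W by (auto simp: arr_def)
  then show "g = h" using g h n by (metis WX.minus_equality WX.minus_minus)
qed

lemma is_mono_comp:
  assumes "is_mono C X Y f" "is_mono C Y Z g" "X \<in> Ob C" "Y \<in> Ob C" "Z \<in> Ob C"
  shows "is_mono C X Z (g \<bullet> f)"
proof (rule is_monoI)
  have a: "arr X Y f" "arr Y Z g" using assms by (auto simp: arr_def is_mono_def)
  then show "arr X Z (g \<bullet> f)" by blast
  show "h = \<zero>[W,X]" if "arr W X h" "g \<bullet> f \<bullet> h = \<zero>[W,Z]" for W h
    using that a assms assoc[OF that(1) a]
      is_mono_zeroD[of Y Z g W "f \<bullet> h"] is_mono_zeroD[of X Y f W h] by auto
qed

lemma is_epi_comp:
  assumes "is_epi C X Y f" "is_epi C Y Z g" "X \<in> Ob C" "Y \<in> Ob C" "Z \<in> Ob C"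
  shows "is_epi C X Z (g \<bullet> f)"
proof (rule is_epiI)
  have a: "arr X Y f" "arr Y Z g" using assms by (auto simp: arr_def is_epi_def)
  then show "arr X Z (g \<bullet> f)" by blast
  show "h = \<zero>[Z,W]" if "arr Z W h" "h \<bullet> (g \<bullet> f) = \<zero>[X,W]" for W h
    using that a assms assoc[OF a that(1)]
      is_epi_zeroD[of X Y f W "h \<bullet> g"] is_epi_zeroD[of Y Z g W h] by auto
qed

section \<open>Kernels and cokernels\<close>

lemma is_kernelD:
  assumes "is_kernel C A i X f Y" "X \<in> Ob C"
  shows "arr A X i" "f \<bullet> i = \<zero>[A,Y]"
  using assms by (auto simp: is_kernel_def arr_def)

lemma is_cokernelD:
  assumes "is_cokernel C X f Y p B" "Y \<in> Ob C"
  shows "arr Y B p" "p \<bullet> f = \<zero>[X,B]"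
  using assms by (auto simp: is_cokernel_def arr_def)

lemma kernel_factor:
  assumes "is_kernel C A i X f Y" "arr W X g" "f \<bullet> g = \<zero>[W,Y]"
  obtains h where "arr W A h" "i \<bullet> h = g"
  using assms by (auto simp: is_kernel_def arr_def) metis

lemma cokernel_factor:
  assumes "is_cokernel C X f Y p B" "arr Y W g" "g \<bullet> f = \<zero>[X,W]"
  obtains h where "arr B W h" "h \<bullet> p = g"
  using assms by (auto simp: is_cokernel_def arr_def) metis

text \<open>The uniqueness clause of the universal property, applied to the common composite
  \<open>i \<bullet> g\<close>, cancels \<open>i\<close>.\<close>

lemma kernel_is_mono:
  assumes k: "is_kernel C A i X f Y" and f: "arr X Y f"
  shows "is_mono C A X i"
  unfolding is_mono_def
proof (intro conjI ballI impI)
  have i: "arr A X i" using is_kernelD k arr_Ob[OF f] by blast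
  then show "i \<in> mor C A X" by (rule arr_mor)
  fix W g h assume W: "W \<in> Ob C" and gh: "g \<in> mor C W A" "h \<in> mor C W A" "i \<bullet> g = i \<bullet> h"
  have a: "arr W A g" using W gh i by (auto simp: arr_def)
  have "f \<bullet> (i \<bullet> g) = \<zero>[W,Y]"
    using assoc[OF a i f] is_kernelD(2)[OF k] a arr_Ob[OF f] by simp
  moreover have "i \<bullet> g \<in> mor C W X" using a i arr_mor arr_comp by blast
  ultimately have "\<exists>!u. u \<in> mor C W A \<and> i \<bullet> u = i \<bullet> g"
    using k W by (auto simp: is_kernel_def)
  then show "g = h" using gh by metis
qed

lemma cokernel_is_epi:
  assumes k: "is_cokernel C X f Y p B" and f: "arr X Y f"
  shows "is_epi C Y B p"
  unfolding is_epi_def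
proof (intro conjI ballI impI)
  have p: "arr Y B p" using is_cokernelD k arr_Ob[OF f] by blast
  then show "p \<in> mor C Y B" by (rule arr_mor)
  fix W g h assume W: "W \<in> Ob C" and gh: "g \<in> mor C B W" "h \<in> mor C B W" "g \<bullet> p = h \<bullet> p"
  have a: "arr B W g" using W gh p by (auto simp: arr_def)
  have "g \<bullet> p \<bullet> f = \<zero>[X,W]"
    using assoc[OF f p a] is_cokernelD(2)[OF k] a arr_Ob[OF f] by simp
  moreover have "g \<bullet> p \<in> mor C Y W" using a p arr_mor arr_comp by blast
  ultimately have "\<exists>!u. u \<in> mor C B W \<and> u \<bullet> p = g \<bullet> p"
    using k W by (auto simp: is_cokernel_def)
  then show "g = h" using gh by metis
qed

text \<open>Uniqueness of the factorization comes from \<open>p\<close> being epi, so only existence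
  is left to check.\<close>

lemma is_cokernelI:
  assumes "arr X Y f" "is_epi C Y B p" "B \<in> Ob C" "p \<bullet> f = \<zero>[X,B]"
    and "\<And>W g. arr Y W g \<Longrightarrow> g \<bullet> f = \<zero>[X,W] \<Longrightarrow> \<exists>h. arr B W h \<and> h \<bullet> p = g"
  shows "is_cokernel C X f Y p B"
  unfolding is_cokernel_def
proof (intro conjI ballI impI)
  show "p \<in> mor C Y B" using assms(2) by (auto simp: is_epi_def)
  fix W g assume W: "W \<in> Ob C" "g \<in> mor C Y W" "g \<bullet> f = \<zero>[X,W]"
  then have "arr Y W g" using arr_Ob[OF assms(1)] by (auto simp: arr_def)
  then obtain h where h: "arr B W h" "h \<bullet> p = g" using assms(5) W by blast
  show "\<exists>!h. h \<in> mor C B W \<and> h \<bullet> p = g"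
  proof (rule ex1I[of _ h])
    show "h \<in> mor C B W \<and> h \<bullet> p = g" using h arr_mor by blast
    fix u assume "u \<in> mor C B W \<and> u \<bullet> p = g"
    then show "u = h" using is_epiD[OF assms(2)] h W assms(3) by (auto simp: arr_def)
  qed
qed (use assms in auto)

lemma is_kernelI:
  assumes "arr X Y f" "is_mono C A X i" "A \<in> Ob C" "f \<bullet> i = \<zero>[A,Y]"
    and "\<And>W g. arr W X g \<Longrightarrow> f \<bullet> g = \<zero>[W,Y] \<Longrightarrow> \<exists>h. arr W A h \<and> i \<bullet> h = g"
  shows "is_kernel C A i X f Y"
  unfolding is_kernel_def
proof (intro conjI ballI impI)
  show "i \<in> mor C A X" using assms(2) by (auto simp: is_mono_def)
  fix W g assume W: "W \<in> Ob C" "g \<in> mor C W X" "f \<bullet> g = \<zero>[W,Y]"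
  then have "arr W X g" using arr_Ob[OF assms(1)] by (auto simp: arr_def)
  then obtain h where h: "arr W A h" "i \<bullet> h = g" using assms(5) W by blast
  show "\<exists>!h. h \<in> mor C W A \<and> i \<bullet> h = g"
  proof (rule ex1I[of _ h])
    show "h \<in> mor C W A \<and> i \<bullet> h = g" using h arr_mor by blast
    fix u assume "u \<in> mor C W A \<and> i \<bullet> u = g"
    then show "u = h" using is_monoD[OF assms(2)] h W assms(3) by (auto simp: arr_def)
  qed
qed (use assms in auto)

section \<open>Zero objects and vanishing Hom\<close>

lemma zero_obj_arr:
  assumes "is_zero_obj C Z"
  shows "arr X Z f \<Longrightarrow> f = \<zero>[X,Z]" "arr Z X f \<Longrightarrow> f = \<zero>[Z,X]"
proof -
  have Z: "Z \<in> Ob C" using assms by (auto simp: is_zero_obj_def)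
  show "f = \<zero>[X,Z]" if f: "arr X Z f"
    using assms f arr_mor[OF f] arr_mor[OF arr_zero[OF arr_Ob[OF f]]] arr_Ob[OF f]
    unfolding is_zero_obj_def by blast
  show "f = \<zero>[Z,X]" if f: "arr Z X f"
    using assms f arr_mor[OF f] arr_mor[OF arr_zero[OF arr_Ob[OF f]]] arr_Ob[OF f]
    unfolding is_zero_obj_def by blast
qed

text \<open>Every morphism into or out of \<open>X\<close> absorbs the identity of \<open>X\<close>,
  so it vanishes together with it.\<close>

lemma is_zero_obj_iff:
  assumes "X \<in> Ob C"
  shows "is_zero_obj C X \<longleftrightarrow> ident C X = \<zero>[X,X]"
proof
  show "is_zero_obj C X \<Longrightarrow> ident C X = \<zero>[X,X]" using zero_obj_arr assms by blast
  assume e: "ident C X = \<zero>[X,X]"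
  have "f = \<zero>[W,X]" if "arr W X f" for W f
    using ident_comp[OF that] zero_comp[OF that assms] e by simp
  moreover have "f = \<zero>[X,W]" if "arr X W f" for W f
    using comp_ident[OF that] comp_zero[OF that assms] e by simp
  ultimately show "is_zero_obj C X"
    using assms arr_zero unfolding is_zero_obj_def arr_def by metis
qed

lemma Hom_vanishes_iff:
  assumes "X \<in> Ob C" "Y \<in> Ob C"
  shows "Hom_vanishes C X Y \<longleftrightarrow> (\<forall>f. arr X Y f \<longrightarrow> f = \<zero>[X,Y])"
  using assms arr_zero[OF assms] by (auto simp: Hom_vanishes_def arr_def)

lemma Hom_vanishes_self: "X \<in> Ob C \<Longrightarrow> Hom_vanishes C X X \<longleftrightarrow> is_zero_obj C X"
  using Hom_vanishes_iff is_zero_obj_iff zero_obj_arr arr_ident by metis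

end


section \<open>Abelian categories\<close>

context abelian_category
begin

text \<open>\<open>p\<close> is the cokernel of some \<open>g\<close>, and \<open>g\<close> factors
  through the kernel \<open>i\<close>; whatever kills \<open>i\<close> therefore kills
  \<open>g\<close> and descends along \<open>p\<close>.\<close>

lemma epi_is_cokernel_of_kernel:
  assumes p: "is_epi C X B p" "X \<in> Ob C" "B \<in> Ob C" and k: "is_kernel C A i X p B"
  shows "is_cokernel C A i X p B"
proof -
  have pa: "arr X B p" using p by (auto simp: is_epi_def arr_def)
  have i: "arr A X i" "p \<bullet> i = \<zero>[A,B]" using is_kernelD[OF k p(2)] by auto
  obtain Z g where g: "arr Z X g" "is_cokernel C Z g X p B"
    using epi_normal[OF p(2,3,1)] p by (auto simp: arr_def)
  obtain u where u: "arr Z A u" "i \<bullet> u = g"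
    using kernel_factor[OF k g(1)] is_cokernelD[OF g(2) p(2)] by metis
  show ?thesis
  proof (rule is_cokernelI[OF i(1) p(1,3) i(2)])
    fix W h assume h: "arr X W h" "h \<bullet> i = \<zero>[A,W]"
    have "h \<bullet> g = \<zero>[Z,W]" using assoc[OF u(1) i(1) h(1)] u h(2) arr_Ob[OF h(1)] by simp
    then show "\<exists>l. arr B W l \<and> l \<bullet> p = h" using cokernel_factor[OF g(2) h(1)] by metis
  qed
qed

lemma short_exact_kernel:
  assumes "is_epi C X B p" "X \<in> Ob C" "B \<in> Ob C" "is_kernel C A i X p B"
  shows "short_exact C A i X p B"
  using epi_is_cokernel_of_kernel assms by (auto simp: short_exact_def)

lemma mono_is_kernel_of_cokernel:
  assumes i: "is_mono C A X i" "A \<in> Ob C" "X \<in> Ob C" and k: "is_cokernel C A i X p B"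
  shows "is_kernel C A i X p B"
proof -
  have ia: "arr A X i" using i by (auto simp: is_mono_def arr_def)
  have p: "arr X B p" "p \<bullet> i = \<zero>[A,B]" using is_cokernelD[OF k i(3)] by auto
  obtain Z g where g: "arr X Z g" "is_kernel C A i X g Z"
    using mono_normal[OF i(2,3,1)] i by (auto simp: arr_def)
  obtain u where u: "arr B Z u" "u \<bullet> p = g"
    using cokernel_factor[OF k g(1)] is_kernelD[OF g(2) i(3)] by metis
  show ?thesis
  proof (rule is_kernelI[OF p(1) i(1,2) p(2)])
    fix W h assume h: "arr W X h" "p \<bullet> h = \<zero>[W,B]"
    have "g \<bullet> h = \<zero>[W,Z]" using assoc[OF h(1) p(1) u(1)] u h(2) arr_Ob[OF h(1)] by simp
    then show "\<exists>l. arr W A l \<and> i \<bullet> l = h" using kernel_factor[OF g(2) h(1)] by metis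
  qed
qed

lemma short_exact_cokernel:
  assumes "is_mono C A X i" "A \<in> Ob C" "X \<in> Ob C" "is_cokernel C A i X p B"
  shows "short_exact C A i X p B"
  using mono_is_kernel_of_cokernel assms by (auto simp: short_exact_def)

lemma short_exactD:
  assumes "short_exact C A i X p B"
  shows "arr A X i" "arr X B p" "is_mono C A X i" "is_epi C X B p"
    "is_kernel C A i X p B" "is_cokernel C A i X p B"
proof -
  show k: "is_kernel C A i X p B" "is_cokernel C A i X p B" and "arr A X i" "arr X B p"
    using assms is_kernelD is_cokernelD by (auto simp: short_exact_def)
  then show "is_mono C A X i" "is_epi C X B p" using kernel_is_mono cokernel_is_epi by blast+
qed

text \<open>If \<open>h\<close> kills \<open>e\<close>, then \<open>e\<close> factors through the
  kernel of \<open>h\<close>, and a section of that kernel forces \<open>h\<close> to be zero.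
  Images, pullbacks and maps into simple objects are shown to be epi in this way.\<close>

lemma is_epiI_split:
  assumes e: "arr X Y e"
    and s: "\<And>N k u. is_mono C N Y k \<Longrightarrow> arr N Y k \<Longrightarrow> arr X N u \<Longrightarrow> k \<bullet> u = e
      \<Longrightarrow> \<exists>s. arr Y N s \<and> k \<bullet> s = ident C Y"
  shows "is_epi C X Y e"
proof (rule is_epiI[OF e])
  fix Z h assume h: "arr Y Z h" "h \<bullet> e = \<zero>[X,Z]"
  have o: "Y \<in> Ob C" "Z \<in> Ob C" using h arr_Ob by auto
  obtain N k where k: "is_kernel C N k Y h Z" using kernel_exists[OF o] h arr_mor by metis
  obtain u where u: "arr X N u" "k \<bullet> u = e" using kernel_factor[OF k e h(2)] by metis
  have ka: "arr N Y k" "h \<bullet> k = \<zero>[N,Z]" using is_kernelD[OF k o(1)] by auto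
  obtain s where s: "arr Y N s" "k \<bullet> s = ident C Y"
    using s[OF kernel_is_mono[OF k h(1)] ka(1) u] by metis
  have "h = h \<bullet> (k \<bullet> s)" using s h by simp
  also have "\<dots> = h \<bullet> k \<bullet> s" using assoc[OF s(1) ka(1) h(1)] by simp
  also have "\<dots> = \<zero>[Y,Z]" using ka s o by simp
  finally show "h = \<zero>[Y,Z]" .
qed

text \<open>Supplies the section asked for by \<open>is_epiI_split\<close>: once \<open>i\<close>
  factors through \<open>i \<bullet> k\<close>, the mono \<open>i\<close> can be cancelled.\<close>

lemma mono_section:
  assumes i: "is_mono C A X i" "arr A X i" and k: "arr N A k" and s: "arr A N s" "i \<bullet> k \<bullet> s = i"
  shows "k \<bullet> s = ident C A"
  using is_monoD[OF i(1), of A "k \<bullet> s" "ident C A"] assoc[OF s(1) k i(2)] s k i arr_Ob[OF k] by auto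

text \<open>The image is realised as the kernel \<open>i\<close> of the cokernel \<open>c\<close> of
  \<open>f\<close>; normality of monomorphisms makes \<open>e\<close> epi.\<close>

lemma image_factorization:
  assumes f: "arr X Y f"
  obtains I e i B c where "arr X I e" "is_epi C X I e" "i \<bullet> e = f" "short_exact C I i Y c B"
proof -
  have o: "X \<in> Ob C" "Y \<in> Ob C" using f arr_Ob by auto
  obtain B c where c: "is_cokernel C X f Y c B" using cokernel_exists[OF o] f arr_mor by metis
  have ca: "arr Y B c" "c \<bullet> f = \<zero>[X,B]" using is_cokernelD[OF c o(2)] by auto
  have B: "B \<in> Ob C" using ca arr_Ob by auto
  obtain I i where i: "is_kernel C I i Y c B" using kernel_exists[OF o(2) B] ca arr_mor by metis
  have ia: "arr I Y i" "c \<bullet> i = \<zero>[I,B]" using is_kernelD[OF i o(2)] by auto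
  have im: "is_mono C I Y i" using kernel_is_mono[OF i ca(1)] .
  obtain e where e: "arr X I e" "i \<bullet> e = f" using kernel_factor[OF i f ca(2)] by metis
  have "is_epi C X I e"
  proof (rule is_epiI_split[OF e(1)])
    fix N k u assume k: "is_mono C N I k" "arr N I k" "arr X N u" "k \<bullet> u = e"
    have o': "N \<in> Ob C" "I \<in> Ob C" using arr_Ob[OF k(2)] by auto
    have "is_mono C N Y (i \<bullet> k)" using is_mono_comp[OF k(1) im] o' o by auto
    then obtain Z g where Z: "Z \<in> Ob C" and g: "g \<in> mor C Y Z" "is_kernel C N (i \<bullet> k) Y g Z"
      using mono_normal o' o by blast
    have ga: "arr Y Z g" using g Z o by (auto simp: arr_def)
    \<comment> \<open>The subobject \<open>N\<close> of \<open>Y\<close> is the kernel of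
      \<open>g\<close>, and \<open>f\<close> factors through \<open>N\<close>. So \<open>g\<close>
      kills \<open>f\<close>, factors through \<open>c\<close> and hence kills \<open>i\<close>;
      this puts \<open>I\<close> inside \<open>N\<close>.\<close>
    have "g \<bullet> f = g \<bullet> (i \<bullet> k) \<bullet> u"
      using assoc[OF k(3) arr_comp[OF k(2) ia(1)] ga] assoc[OF k(3,2) ia(1)] k(4) e(2) by simp
    also have "\<dots> = \<zero>[X,Z]" using is_kernelD(2)[OF g(2) o(2)] k Z by simp
    finally obtain w where w: "arr B Z w" "w \<bullet> c = g" using cokernel_factor[OF c ga] by metis
    have "g \<bullet> i = \<zero>[I,Z]" using assoc[OF ia(1) ca(1) w(1)] w ia o' by auto
    then obtain s where s: "arr I N s" "i \<bullet> k \<bullet> s = i" using kernel_factor[OF g(2) ia(1)] by metis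
    then show "\<exists>s. arr I N s \<and> k \<bullet> s = ident C I" using mono_section[OF im ia(1) k(2)] by blast
  qed
  then show thesis
    using that[OF e(1) _ e(2)] short_exact_kernel[OF cokernel_is_epi[OF c f] o(2) B i] by blast
qed

text \<open>\<open>T\<close> is the preimage of \<open>T'\<close> under \<open>c\<close>, so this is stability of epimorphisms under pullback along
  a monomorphism.\<close>

lemma epi_between_kernels:
  assumes c: "is_epi C M B c" "arr M B c" and p: "arr B F p"
    and t: "short_exact C T i M (p \<bullet> c) F" and t': "is_kernel C T' i' B p F"
    and e: "arr T T' e" "i' \<bullet> e = c \<bullet> i"
  shows "is_epi C T T' e"
proof (rule is_epiI_split[OF e(1)])
  fix N k u assume k: "is_mono C N T' k" "arr N T' k" "arr T N u" "k \<bullet> u = e"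
  have ia: "arr T M i" using short_exactD[OF t] by auto
  have o: "B \<in> Ob C" "M \<in> Ob C" "T \<in> Ob C" "T' \<in> Ob C" "N \<in> Ob C" "F \<in> Ob C"
    using arr_Ob c ia e k p by blast+
  have i': "arr T' B i'" "p \<bullet> i' = \<zero>[T',F]" using is_kernelD[OF t' o(1)] by auto
  have i'm: "is_mono C T' B i'" using kernel_is_mono[OF t' p] .
  obtain Z q where Z: "Z \<in> Ob C" and q0: "q \<in> mor C B Z" and q: "is_kernel C N (i' \<bullet> k) B q Z"
    using mono_normal[OF o(5,1) is_mono_comp[OF k(1) i'm]] o by blast
  have qa: "arr B Z q" using q0 o Z by (auto simp: arr_def)
  have ci: "c \<bullet> i = i' \<bullet> k \<bullet> u" using e(2) k(4) assoc[OF k(3,2) i'(1)] by simp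
  \<comment> \<open>\<open>T\<close> maps into \<open>N\<close>, so \<open>q \<bullet> c\<close>
    kills \<open>T\<close> and descends to a map \<open>w\<close> on \<open>F\<close>. Cancelling
    the epi \<open>c\<close> gives \<open>w \<bullet> p = q\<close>, whence \<open>q\<close> kills
    \<open>T'\<close> and \<open>T'\<close> lies in \<open>N\<close>.\<close>
  have "q \<bullet> c \<bullet> i = q \<bullet> (i' \<bullet> k) \<bullet> u"
    using assoc[OF ia c(2) qa] assoc[OF k(3) arr_comp[OF k(2) i'(1)] qa] ci by simp
  also have "\<dots> = \<zero>[T,Z]" using is_kernelD(2)[OF q o(1)] k Z by simp
  finally obtain w where w: "arr F Z w" "w \<bullet> (p \<bullet> c) = q \<bullet> c"
    using cokernel_factor[OF short_exactD(6)[OF t] arr_comp[OF c(2) qa]] by metis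
  have "w \<bullet> p = q"
    using is_epiD[OF c(1) arr_comp[OF p w(1)] qa] w(2) assoc[OF c(2) p w(1)] by simp
  then have "q \<bullet> i' = \<zero>[T',Z]" using assoc[OF i'(1) p w(1)] i' w o by auto
  then obtain s where s: "arr T' N s" "i' \<bullet> k \<bullet> s = i'" using kernel_factor[OF q i'(1)] by metis
  then show "\<exists>s. arr T' N s \<and> k \<bullet> s = ident C T'" using mono_section[OF i'm i'(1) k(2)] by blast
qed

text \<open>A subobject through which a non-zero map factors is itself non-zero, so in a simple
  target it is everything.\<close>

lemma is_epi_into_simple:
  assumes S: "is_simple C S" and a: "arr X S a" "a \<noteq> \<zero>[X,S]"
  shows "is_epi C X S a"
proof (rule is_epiI_split[OF a(1)])
  fix N k u assume k: "is_mono C N S k" "arr N S k" "arr X N u" "k \<bullet> u = a"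
  have o: "N \<in> Ob C" "X \<in> Ob C" "S \<in> Ob C" using arr_Ob k(2) a by auto
  have "\<not> is_zero_obj C N"
  proof
    assume "is_zero_obj C N"
    then have "u = \<zero>[X,N]" using zero_obj_arr k(3) by blast
    then show False using k a o by simp
  qed
  then have "is_iso C N S k" using S k(1) o by (auto simp: is_simple_def)
  then show "\<exists>s. arr S N s \<and> k \<bullet> s = ident C S" using o by (auto simp: is_iso_def arr_def)
qed


section \<open>Length\<close>

text \<open>An inductive form of \<open>finite_length\<close>, with \<open>'b\<close> the type of
  objects. It is a relation rather than a function: it records the number of steps of some
  composition series.\<close>

inductive has_length :: "nat \<Rightarrow> 'b \<Rightarrow> bool" where
  zero: "is_zero_obj C M \<Longrightarrow> has_length 0 M"
| step: "has_length n Y \<Longrightarrow> short_exact C Y i M p S \<Longrightarrow> is_simple C S \<Longrightarrow> has_length (Suc n) M"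

lemma finite_length_has_length:
  assumes "finite_length C X"
  shows "\<exists>n. has_length n X"
proof -
  obtain n Y i p S where *: "is_zero_obj C (Y 0)" "Y n = X"
    "\<And>r. r < n \<Longrightarrow> short_exact C (Y r) (i r) (Y (Suc r)) (p r) (S r) \<and> is_simple C (S r)"
    using assms unfolding finite_length_def by blast
  have "r \<le> n \<Longrightarrow> has_length r (Y r)" for r
  proof (induction r)
    case 0 then show ?case using * has_length.zero by blast
  next
    case (Suc r)
    then show ?case using *(3)[of r] has_length.step[of r "Y r"] by auto
  qed
  then show ?thesis using * by auto
qed

text \<open>The strict drop for non-monic \<open>b\<close> lets a later induction pass to proper
  quotients. The proof compares the top factor \<open>S\<close> of \<open>M\<close> with the kernel
  \<open>L\<close> of \<open>b\<close>.\<close>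

lemma has_length_quotient:
  assumes "has_length n M" "is_epi C M B b" "arr M B b"
  shows "\<exists>m\<le>n. has_length m B \<and> (m < n \<or> is_mono C M B b)"
  using assms
proof (induction arbitrary: B b rule: has_length.induct)
  case (zero M)
  have o: "B \<in> Ob C" "M \<in> Ob C" using arr_Ob zero by auto
  have "b = \<zero>[M,B]" using zero_obj_arr zero by blast
  then have "ident C B = \<zero>[B,B]"
    using is_epi_zeroD[OF zero(2) o(2) arr_ident[OF o(1)]] zero(3) by simp
  then have "has_length 0 B" using is_zero_obj_iff[OF o(1)] has_length.zero by blast
  moreover have "is_mono C M B b" by (rule is_monoI[OF zero(3)]) (use zero_obj_arr zero in blast)
  ultimately show ?case by auto
next
  case (step n Y i M \<sigma> S)
  note s = short_exactD[OF step.hyps(2)]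
  note b = step.prems
  have o: "B \<in> Ob C" "M \<in> Ob C" "Y \<in> Ob C" "S \<in> Ob C" using arr_Ob s(1,2) b by auto
  obtain L l where l: "is_kernel C L l M b B" using kernel_exists[OF o(2,1)] b arr_mor by metis
  have la: "arr L M l" "b \<bullet> l = \<zero>[L,B]" using is_kernelD[OF l o(2)] by auto
  show ?case
  proof (cases "\<sigma> \<bullet> l = \<zero>[L,S]")
    case True
    \<comment> \<open>\<open>L\<close> lies in \<open>Y\<close>, so \<open>\<sigma>\<close> descends
      to \<open>\<tau>\<close> on \<open>B\<close>, and \<open>B\<close> has top factor
      \<open>S\<close> with kernel \<open>Y'\<close>. As \<open>Y'\<close> is a quotient of
      \<open>Y\<close>, the induction hypothesis bounds its length.\<close>
    have "is_cokernel C L l M b B" using epi_is_cokernel_of_kernel[OF b(1) o(2,1) l] .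
    then obtain \<tau> where \<tau>: "arr B S \<tau>" "\<tau> \<bullet> b = \<sigma>"
      using cokernel_factor[OF _ s(2) True] by metis
    have \<tau>e: "is_epi C B S \<tau>"
    proof (rule is_epiI[OF \<tau>(1)])
      fix Z h assume h: "arr S Z h" "h \<bullet> \<tau> = \<zero>[B,Z]"
      have "h \<bullet> \<sigma> = \<zero>[M,Z]" using assoc[OF b(2) \<tau>(1) h(1)] \<tau> h b arr_Ob[OF h(1)] by simp
      then show "h = \<zero>[S,Z]" using is_epi_zeroD[OF s(4) o(2) h(1)] by blast
    qed
    obtain Y' i' where i': "is_kernel C Y' i' B \<tau> S"
      using kernel_exists[OF o(1,4)] \<tau> arr_mor by metis
    have i'a: "arr Y' B i'" using is_kernelD[OF i' o(1)] by auto
    have "\<tau> \<bullet> (b \<bullet> i) = \<zero>[Y,S]"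
      using assoc[OF s(1) b(2) \<tau>(1)] \<tau> is_kernelD(2)[OF s(5) o(2)] by simp
    then obtain y where y: "arr Y Y' y" "i' \<bullet> y = b \<bullet> i"
      using kernel_factor[OF i' arr_comp[OF s(1) b(2)]] by metis
    have "is_epi C Y Y' y"
      using epi_between_kernels[OF b(1,2) \<tau>(1) _ i' y] step.hyps(2) \<tau>(2) by simp
    then obtain m where m: "m \<le> n" "has_length m Y'" "m < n \<or> is_mono C Y Y' y"
      using step.IH y by blast
    have "has_length (Suc m) B"
      using has_length.step[OF m(2) short_exact_kernel[OF \<tau>e o(1,4) i'] step.hyps(3)] .
    \<comment> \<open>Anything killed by \<open>b\<close> is killed by \<open>\<sigma>\<close> and
      so comes from \<open>Y\<close>, where \<open>y\<close> detects it.\<close>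
    moreover have "is_mono C M B b" if ym: "is_mono C Y Y' y"
    proof (rule is_monoI[OF b(2)])
      fix W g assume g: "arr W M g" "b \<bullet> g = \<zero>[W,B]"
      have W: "W \<in> Ob C" using g arr_Ob by auto
      have "\<sigma> \<bullet> g = \<zero>[W,S]" using assoc[OF g(1) b(2) \<tau>(1)] \<tau> g W by simp
      then obtain g' where g': "arr W Y g'" "i \<bullet> g' = g" using kernel_factor[OF s(5) g(1)] by metis
      have "i' \<bullet> (y \<bullet> g') = \<zero>[W,B]"
        using assoc[OF g'(1) y(1) i'a] y assoc[OF g'(1) s(1) b(2)] g' g by simp
      then have "y \<bullet> g' = \<zero>[W,Y']"
        using is_mono_zeroD[OF kernel_is_mono[OF i' \<tau>(1)] o(1) arr_comp[OF g'(1) y(1)]] by blast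
      then have "g' = \<zero>[W,Y]" using is_mono_zeroD[OF ym _ g'(1)] arr_Ob[OF y(1)] by blast
      then show "g = \<zero>[W,M]" using g' s W by simp
    qed
    ultimately show ?thesis using m by (intro exI[of _ "Suc m"]) auto
  next
    case False
    \<comment> \<open>\<open>L\<close> is not contained in \<open>Y\<close>, so it maps onto the
      simple \<open>S\<close> and together with \<open>Y\<close> fills \<open>M\<close>. Since
      \<open>b\<close> kills \<open>L\<close>, already \<open>Y\<close> maps onto \<open>B\<close>,
      and a length at most \<open>n\<close> is strictly below \<open>Suc n\<close>.\<close>
    have ae: "is_epi C L S (\<sigma> \<bullet> l)"
      using is_epi_into_simple[OF step.hyps(3) arr_comp[OF la(1) s(2)] False] .
    have bi: "arr Y B (b \<bullet> i)" using s(1) b by blast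
    have "is_epi C Y B (b \<bullet> i)"
    proof (rule is_epiI[OF bi])
      fix Z h assume h: "arr B Z h" "h \<bullet> (b \<bullet> i) = \<zero>[Y,Z]"
      have Z: "Z \<in> Ob C" using h arr_Ob by auto
      have "h \<bullet> b \<bullet> i = \<zero>[Y,Z]" using assoc[OF s(1) b(2) h(1)] h by simp
      then obtain w where w: "arr S Z w" "w \<bullet> \<sigma> = h \<bullet> b"
        using cokernel_factor[OF s(6) arr_comp[OF b(2) h(1)]] by metis
      have "w \<bullet> (\<sigma> \<bullet> l) = h \<bullet> (b \<bullet> l)"
        using assoc[OF la(1) s(2) w(1)] w assoc[OF la(1) b(2) h(1)] by simp
      also have "\<dots> = \<zero>[L,Z]" using la h arr_Ob[OF la(1)] by simp
      finally have "w = \<zero>[S,Z]" using is_epi_zeroD[OF ae _ w(1)] arr_Ob[OF la(1)] by blast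
      then have "h \<bullet> b = \<zero>[M,Z]" using w s Z by simp
      then show "h = \<zero>[B,Z]" using is_epi_zeroD[OF b(1) o(2) h(1)] by blast
    qed
    then obtain m where "m \<le> n" "has_length m B" using step.IH bi by blast
    then show ?thesis by (intro exI[of _ m]) auto
  qed
qed

lemma is_zero_obj_zero_mono:
  assumes "is_mono C A X i" "arr A X i" "i = \<zero>[A,X]"
  shows "is_zero_obj C A"
  using assms arr_Ob[OF assms(2)] is_zero_obj_iff
    is_mono_zeroD[OF assms(1) _ arr_ident] comp_ident[OF assms(2)] by metis

end


section \<open>Torsion pairs\<close>

context linear_category
begin

lemma right_perp_iff:
  assumes "D \<subseteq> Ob C"
  shows "M \<in> right_perp C D \<longleftrightarrow> M \<in> Ob C \<and> (\<forall>X\<in>D. \<forall>f. arr X M f \<longrightarrow> f = \<zero>[X,M])"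
  using assms Hom_vanishes_iff unfolding right_perp_def by auto

lemma left_perp_iff:
  assumes "D \<subseteq> Ob C"
  shows "M \<in> left_perp C D \<longleftrightarrow> M \<in> Ob C \<and> (\<forall>X\<in>D. \<forall>f. arr M X f \<longrightarrow> f = \<zero>[M,X])"
  using assms Hom_vanishes_iff unfolding left_perp_def by auto

end

section \<open>Perpendicular classes and their closures\<close>

lemma right_perp_subset_Ob: "right_perp C D \<subseteq> Ob C"
  and left_perp_subset_Ob: "left_perp C D \<subseteq> Ob C"
  by (auto simp: right_perp_def left_perp_def)

lemma right_perp_antimono: "D \<subseteq> E \<Longrightarrow> right_perp C E \<subseteq> right_perp C D"
  and left_perp_antimono: "D \<subseteq> E \<Longrightarrow> left_perp C E \<subseteq> left_perp C D"
  by (auto simp: right_perp_def left_perp_def)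

lemma torsion_closure_mono: "D \<subseteq> E \<Longrightarrow> torsion_closure C D \<subseteq> torsion_closure C E"
  unfolding torsion_closure_def by (intro left_perp_antimono right_perp_antimono)

lemma subset_torsion_closure: "D \<subseteq> Ob C \<Longrightarrow> D \<subseteq> torsion_closure C D"
  and subset_torsion_free_closure: "D \<subseteq> Ob C \<Longrightarrow> D \<subseteq> torsion_free_closure C D"
  by (auto simp: torsion_closure_def torsion_free_closure_def right_perp_def left_perp_def)

text \<open>The triple-perpendicular identity of a Galois connection: one inclusion holds because
  \<open>D\<close> lies in \<open>torsion_free_closure C D\<close>, the other because a class lies
  in its closure.\<close>

lemma torsion_closure_left_perp:
  assumes "D \<subseteq> Ob C"
  shows "torsion_closure C (left_perp C D) = left_perp C D"
proof
  show "torsion_closure C (left_perp C D) \<subseteq> left_perp C D"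
    using left_perp_antimono[OF subset_torsion_free_closure[OF assms]]
    by (simp add: torsion_closure_def torsion_free_closure_def)
qed (rule subset_torsion_closure[OF left_perp_subset_Ob])

lemma torsion_pair_Hom_vanishes:
  "torsion_pair C (T, F) \<Longrightarrow> X \<in> T \<Longrightarrow> Y \<in> F \<Longrightarrow> Hom_vanishes C X Y"
  by (auto simp: torsion_pair_def)

section \<open>Existence of torsion sequences\<close>

context abelian_length_category
begin

text \<open>Strong induction on a length of \<open>M\<close>, since the quotient by an image may be
  shorter by more than one.\<close>

lemma torsion_sequence_exists:
  assumes D: "D \<subseteq> Ob C" and "has_length n M" "M \<in> Ob C"
  shows "\<exists>t\<in>torsion_closure C D. \<exists>f\<in>right_perp C D. \<exists>i p. short_exact C t i M p f"
  using assms(2,3)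
proof (induction n arbitrary: M rule: less_induct)
  case (less n)
  note M = less.prems(2)
  note T_iff = left_perp_iff[OF right_perp_subset_Ob, folded torsion_closure_def]
  show ?case
  proof (cases "M \<in> right_perp C D")
    case True
    \<comment> \<open>\<open>M\<close> is torsion-free, so its torsion part is zero; the kernel of
      the identity serves as that zero object.\<close>
    obtain A i where k: "is_kernel C A i M (ident C M) M"
      using kernel_exists[OF M M] ident_mor[OF M] by blast
    have id: "is_epi C M M (ident C M)" by (rule is_epiI) (use M in auto)
    have se: "short_exact C A i M (ident C M) M" using short_exact_kernel[OF id M M k] .
    have ia: "arr A M i" "i = \<zero>[A,M]" using is_kernelD[OF k M] by auto
    have "is_zero_obj C A"
      using is_zero_obj_zero_mono[OF kernel_is_mono[OF k arr_ident[OF M]] ia] .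
    then have "A \<in> torsion_closure C D"
      using zero_obj_arr arr_Ob[OF ia(1)] by (auto simp: T_iff)
    then show ?thesis using True se by blast
  next
    case False
    then obtain X \<phi> where X: "X \<in> D" and \<phi>: "arr X M \<phi>" "\<phi> \<noteq> \<zero>[X,M]"
      using right_perp_iff[OF D] M by blast
    have XT: "X \<in> torsion_closure C D" using subset_torsion_closure[OF D] X by blast
    obtain I e j B c where e: "arr X I e" "is_epi C X I e" "j \<bullet> e = \<phi>"
      and j: "short_exact C I j M c B" using image_factorization[OF \<phi>(1)] by metis
    note js = short_exactD[OF j]
    have o: "X \<in> Ob C" "I \<in> Ob C" "B \<in> Ob C" using arr_Ob e(1) js(2) by auto
    \<comment> \<open>A quotient of the torsion object \<open>X\<close> is torsion: a map from
      \<open>I\<close> to a torsion-free object dies on \<open>X\<close>, and \<open>e\<close> is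
      epi.\<close>
    have IT: "I \<in> torsion_closure C D"
      unfolding T_iff
    proof (intro conjI ballI allI impI)
      fix F g assume F: "F \<in> right_perp C D" and g: "arr I F g"
      have "g \<bullet> e = \<zero>[X,F]" using XT F g e(1) by (auto simp: T_iff)
      then show "g = \<zero>[I,F]" using is_epi_zeroD[OF e(2) o(1) g] by blast
    qed (rule o)
    \<comment> \<open>\<open>c\<close> kills the non-zero \<open>\<phi>\<close>; thus
      \<open>B\<close> is strictly shorter than \<open>M\<close> and the induction hypothesis
      applies to it.\<close>
    have "\<not> is_mono C M B c"
    proof
      assume m: "is_mono C M B c"
      have "c \<bullet> \<phi> = \<zero>[X,B]"
        using assoc[OF e(1) js(1,2)] e is_kernelD(2)[OF js(5) M] o by simp
      then show False using is_mono_zeroD[OF m o(3) \<phi>(1)] \<phi>(2) by blast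
    qed
    then obtain m where "m < n" "has_length m B"
      using has_length_quotient[OF less.prems(1) js(4,2)] by blast
    then obtain t' f i' p where t': "t' \<in> torsion_closure C D" and f: "f \<in> right_perp C D"
      and se': "short_exact C t' i' B p f"
      using less.IH o(3) by blast
    note s' = short_exactD[OF se']
    have of: "f \<in> Ob C" "t' \<in> Ob C" using arr_Ob s'(1,2) by auto
    have pc: "arr M f (p \<bullet> c)" using js(2) s'(2) by blast
    \<comment> \<open>\<open>t\<close> is the preimage of \<open>t'\<close> under \<open>c\<close>,
      written as the kernel of the composite onto \<open>f\<close> so that the quotient is the
      torsion-free \<open>f\<close>.\<close>
    obtain t i where i: "is_kernel C t i M (p \<bullet> c) f"
      using kernel_exists[OF M of(1)] pc arr_mor by metis
    have se: "short_exact C t i M (p \<bullet> c) f"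
      using short_exact_kernel[OF is_epi_comp[OF js(4) s'(4)] M of(1) i] M o of by blast
    note s = short_exactD[OF se]
    have ot: "t \<in> Ob C" using arr_Ob s(1) by auto
    have "p \<bullet> (c \<bullet> i) = \<zero>[t,f]" using assoc[OF s(1) js(2) s'(2)] is_kernelD(2)[OF i M] by simp
    then obtain r where r: "arr t t' r" "i' \<bullet> r = c \<bullet> i"
      using kernel_factor[OF s'(5) arr_comp[OF s(1) js(2)]] by metis
    have re: "is_epi C t t' r" using epi_between_kernels[OF js(4,2) s'(2) se s'(5) r] .
    \<comment> \<open>\<open>t\<close> is an extension of \<open>t'\<close> by the kernel
      \<open>N\<close> of \<open>r\<close>, and \<open>N\<close> lies in \<open>I\<close> because
      \<open>c\<close> kills it.\<close>
    obtain N k where k: "is_kernel C N k t r t'" using kernel_exists[OF ot of(2)] r arr_mor by metis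
    have ka: "arr N t k" "r \<bullet> k = \<zero>[N,t']" using is_kernelD[OF k ot] by auto
    have N: "N \<in> Ob C" using arr_Ob ka by auto
    have "c \<bullet> (i \<bullet> k) = \<zero>[N,B]"
      using assoc[OF ka(1) s(1) js(2)] r assoc[OF ka(1) r(1) s'(1)] ka(2) s'(1) N by simp
    then obtain u where u: "arr N I u" "j \<bullet> u = i \<bullet> k"
      using kernel_factor[OF js(5) arr_comp[OF ka(1) s(1)]] by metis
    have "p \<bullet> c \<bullet> j = \<zero>[I,f]"
      using assoc[OF js(1,2) s'(2)] is_kernelD(2)[OF js(5) M] s'(2) o by simp
    then obtain v where v: "arr I t v" "i \<bullet> v = j" using kernel_factor[OF i js(1)] by metis
    have kvu: "v \<bullet> u = k"
      using is_monoD[OF s(3) arr_comp[OF u(1) v(1)] ka(1)] assoc[OF u(1) v(1) s(1)] u v by simp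
    \<comment> \<open>A map \<open>g\<close> to a torsion-free object vanishes on the torsion
      \<open>I\<close>, hence on \<open>N\<close>; so it factors through the torsion
      \<open>t'\<close> and is zero.\<close>
    have "t \<in> torsion_closure C D"
      unfolding T_iff
    proof (intro conjI ballI allI impI)
      fix F g assume F: "F \<in> right_perp C D" and g: "arr t F g"
      have oF: "F \<in> Ob C" using arr_Ob g by auto
      have "g \<bullet> v = \<zero>[I,F]" using IT F g v(1) by (auto simp: T_iff)
      then have "g \<bullet> k = \<zero>[N,F]" using assoc[OF u(1) v(1) g] kvu u oF by simp
      then obtain w where w: "arr t' F w" "w \<bullet> r = g"
        using cokernel_factor[OF epi_is_cokernel_of_kernel[OF re ot of(2) k] g] by metis
      have "w = \<zero>[t',F]" using t' F w by (auto simp: T_iff)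
      then show "g = \<zero>[t,F]" using w r oF by simp
    qed (rule ot)
    then show ?thesis using f se by blast
  qed
qed

lemma torsion_pair_torsion_closure:
  assumes "D \<subseteq> Ob C"
  shows "torsion_pair C (torsion_closure C D, right_perp C D)"
proof -
  have "\<exists>t\<in>torsion_closure C D. \<exists>f\<in>right_perp C D. \<exists>i p. short_exact C t i M p f"
    if "M \<in> Ob C" for M
    using torsion_sequence_exists[OF assms] finite_length_has_length[OF all_finite_length] that
    by blast
  moreover have "Hom_vanishes C X Y" if "X \<in> torsion_closure C D" "Y \<in> right_perp C D" for X Y
    using that by (auto simp: torsion_closure_def left_perp_def)
  ultimately show ?thesis
    unfolding torsion_pair_def
    using left_perp_subset_Ob[of C "right_perp C D"] right_perp_subset_Ob[of C D]
    by (simp add: torsion_closure_def)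
qed

lemma torsion_pair_torsion_free_closure:
  assumes "D \<subseteq> Ob C"
  shows "torsion_pair C (left_perp C D, torsion_free_closure C D)"
  using torsion_pair_torsion_closure[OF left_perp_subset_Ob] torsion_closure_left_perp[OF assms]
  by (metis torsion_free_closure_def)

end


section \<open>Pre-stratifying systems\<close>

theorem corollary4p6:
  fixes K :: "'k ring" and C :: "('k, 'o, 'm) lin_cat"
    and \<Omega> :: "'g :: linorder \<Rightarrow> 'o"
  assumes "abelian_length_category K C"
    and "pre_stratifying_system C \<Omega>"
  shows "\<exists>\<Gamma> \<Gamma>'. nested_family C \<Gamma> \<and> nested_family C \<Gamma>' \<and> \<Gamma> \<noteq> \<Gamma>' \<and>
    induces C \<Omega> \<Gamma> \<and> induces C \<Omega> \<Gamma>' \<and>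
    \<Omega> \<in> Ob (M_star C \<Gamma>) \<and> \<Omega> \<in> Ob (N_star C \<Gamma>')"
proof -
  interpret abelian_length_category K C by (rule assms(1))
  have Om: "\<Omega> k \<in> Ob C" and nz: "\<not> is_zero_obj C (\<Omega> k)" for k
    using assms(2) by (auto simp: pre_stratifying_system_def)
  have hv: "Hom_vanishes C (\<Omega> k) (\<Omega> j)" if "j < k" for k j
    using assms(2) that by (auto simp: pre_stratifying_system_def)
  have nself: "\<not> Hom_vanishes C (\<Omega> k) (\<Omega> k)" for k
    using Hom_vanishes_self Om nz by blast
  define U where "U k = {\<Omega> j | j. j \<ge> k}" for k
  define L where "L k = {\<Omega> j | j. j \<le> k}" for k
  have U: "U k \<subseteq> Ob C" and L: "L k \<subseteq> Ob C" for k using Om by (auto simp: U_def L_def)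
  \<comment> \<open>The T-induced family comes from the upper segments \<open>U k\<close>, the
    F-induced one from the lower segments \<open>L k\<close>.\<close>
  define \<Gamma> where "\<Gamma> = (\<lambda>k. (torsion_closure C (U k), right_perp C (U k)))"
  define \<Gamma>' where "\<Gamma>' = (\<lambda>k. (left_perp C (L k), torsion_free_closure C (L k)))"
  have tp: "torsion_pair C (\<Gamma> k)" "torsion_pair C (\<Gamma>' k)" for k
    unfolding \<Gamma>_def \<Gamma>'_def
    using torsion_pair_torsion_closure[OF U] torsion_pair_torsion_free_closure[OF L] by auto
  have "\<Omega> k \<in> U k" "\<Omega> k \<in> L k" for k by (auto simp: U_def L_def)
  then have T: "\<Omega> k \<in> fst (\<Gamma> k)" and F': "\<Omega> k \<in> snd (\<Gamma>' k)" for k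
    using subsetD[OF subset_torsion_closure[OF U]] subsetD[OF subset_torsion_free_closure[OF L]]
    by (simp_all add: \<Gamma>_def \<Gamma>'_def)
  \<comment> \<open>The generators of \<open>\<Gamma> j\<close> have indices at least
    \<open>j\<close>, hence above \<open>k\<close>, so none of them maps non-trivially to
    \<open>\<Omega> k\<close>.\<close>
  have F: "\<Omega> k \<in> snd (\<Gamma> j)" if "k < j" for k j
    using Om hv that by (auto simp: \<Gamma>_def U_def right_perp_def)
  have T': "\<Omega> k \<in> fst (\<Gamma>' j)" if "j < k" for k j
    using Om hv that by (auto simp: \<Gamma>'_def L_def left_perp_def)
  \<comment> \<open>Otherwise \<open>\<Omega> k\<close> would be both torsion and torsion-free for
    \<open>\<Gamma> j\<close>, and its identity would vanish.\<close>
  have nT: "\<Omega> k \<notin> fst (\<Gamma> j)" if "k < j" for k j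
    using torsion_pair_Hom_vanishes[of C "fst (\<Gamma> j)" "snd (\<Gamma> j)"] tp F[OF that] nself
    by (metis prod.collapse)
  have nF': "\<Omega> k \<notin> snd (\<Gamma>' j)" if "j < k" for k j
    using torsion_pair_Hom_vanishes[of C "fst (\<Gamma>' j)" "snd (\<Gamma>' j)"] tp T'[OF that] nself
    by (metis prod.collapse)
  have nT': "\<Omega> k \<notin> fst (\<Gamma>' k)" for k
    using nself by (auto simp: \<Gamma>'_def L_def left_perp_def)
  have "fst (\<Gamma> l) \<subset> fst (\<Gamma> k)" if "k < l" for k l
  proof -
    have "U l \<subseteq> U k" using that by (auto simp: U_def)
    then have "fst (\<Gamma> l) \<subseteq> fst (\<Gamma> k)" using torsion_closure_mono by (simp add: \<Gamma>_def)
    \<comment> \<open>Strictness is witnessed by \<open>\<Omega> k\<close>, at the smaller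
      index.\<close>
    then show ?thesis using T nT[OF that] by blast
  qed
  then have nested: "nested_family C \<Gamma>" using tp by (simp add: nested_family_def)
  have "fst (\<Gamma>' l) \<subset> fst (\<Gamma>' k)" if "k < l" for k l
  proof -
    have "L k \<subseteq> L l" using that by (auto simp: L_def)
    then have "fst (\<Gamma>' l) \<subseteq> fst (\<Gamma>' k)" using left_perp_antimono by (simp add: \<Gamma>'_def)
    \<comment> \<open>Here the witness is \<open>\<Omega> l\<close>, at the larger index.\<close>
    then show ?thesis using T'[OF that] nT' by blast
  qed
  then have nested': "nested_family C \<Gamma>'" using tp by (simp add: nested_family_def)
  have "T_induces C \<Omega> \<Gamma>" using nested by (simp add: T_induces_def \<Gamma>_def U_def)
  moreover have "F_induces C \<Omega> \<Gamma>'" using nested' by (simp add: F_induces_def \<Gamma>'_def L_def)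
  \<comment> \<open>At any index \<open>k\<close>, \<open>\<Omega> k\<close> is torsion for
    \<open>\<Gamma> k\<close> but not for \<open>\<Gamma>' k\<close>; an index exists since types
    are inhabited.\<close>
  moreover have "\<Gamma> \<noteq> \<Gamma>'" using T nT' by metis
  moreover have "\<Omega> \<in> Ob (M_star C \<Gamma>)"
    using Om nz T nT F by (auto simp: M_star_def full_subcategory_def Gr_def)
  moreover have "\<Omega> \<in> Ob (N_star C \<Gamma>')"
    using Om nz F' nF' T' by (auto simp: N_star_def full_subcategory_def Gr_def)
  ultimately show ?thesis using nested nested' unfolding induces_def by blast
qed

end
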